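(* Let $N\ge2$, let $a,b,\theta>0$ and let $s\in\mathbb{C}$ with $\Re(a-s/2)>0$. Then $$ \int_0^1 du_1\cdots\int_0^1 du_N\; V_N^{(s/2)}(\mathbf{u})\,V_N^{(0)}(\mathbf{u})\prod_{n=1}^N u_n^{a-1}(1-u_n)^{b-1} =\frac{2N^{s/2}S_N(a,b,1)}{s\,\Gamma_{N-1}\left(\frac s2\right)}\,\frac{\Gamma(a+b-1+N)}{\Gamma\left(a-\frac s2+b-1+N\right)}\,\frac{\Gamma\left(a-\frac s2\right)}{\Gamma(a)} $$ and $$ \int_0^\infty du_1\cdots\int_0^\infty du_N\; V_N^{(s/2)}(\mathbf{u})\,V_N^{(0)}(\mathbf{u})\prod_{n=1}^N u_n^{a-1}e^{-u_n/\theta} =\left(\prod_{n=0}^{N-1}\Gamma(a+n)\Gamma(2+n)\right)\frac{2\,\theta^{(a+N)N}}{s\,\Gamma_{N-1}\left(\frac s2\right)}\left(\frac N\theta\right)^{s/2}\frac{\Gamma\left(a-\frac s2\right)}{\Gamma(a)}. $$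
   Context: For $\mathbf{u}=(u_1,\dots,u_N)$ with positive entries, $V_N^{(s/2)}(\mathbf{u})$ is the determinant of the $N\times N$ matrix whose $i$-th row is $(u_i^{-s/2},u_i,u_i^2,\dots,u_i^{N-1})$; in particular $V_N^{(0)}(\mathbf{u})=\prod_{1\le i<j\le N}(u_j-u_i)$. Complex powers of positive reals use the real logarithm. The Selberg integral constant is $$S_N(a,b,1)=\prod_{n=0}^{N-1}\frac{\Gamma(a+n)\Gamma(b+n)\Gamma(2+n)}{\Gamma(a+b-1+N+n)}.$$ For $N>1$, $$\Gamma_{N-1}\left(\tfrac s2\right)=\frac2s\prod_{n=1}^{N-1}\frac{(1+\frac1n)^{s/2}}{1+\frac{s}{2n}},$$ and the factor $\frac{2}{s\Gamma_{N-1}(s/2)}$ is understood for all $s\in\mathbb{C}$ as the entire function $\prod_{n=1}^{N-1}\left(1+\frac{s}{2n}\right)\left(1+\frac1n\right)^{-s/2}$.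
   Formalization: In the second formula the printed power θ^{(a+N)N} is replaced by θ^{(a+N-1)N}; by the scaling u=θv the printed power is false for θ≠1 (e.g. N=2, a=1, s=0, θ=2: the integral is 32, the printed right side is 128). *)

theory Defs
  imports
    "HOL-Analysis.Analysis"
    "Jordan_Normal_Form.Determinant"
begin

(* Rows and columns are indexed from 0, so u 0, ..., u (N - 1) are the N variables.
   The parameter z plays the role of s/2.  For u i > 0, the complex power uses the real
   logarithm of u i, since Ln (of_real x) = of_real (ln x) for x > 0. *)
definition gen_vandermonde :: "nat \<Rightarrow> complex \<Rightarrow> (nat \<Rightarrow> real) \<Rightarrow> complex" where
  "gen_vandermonde N z u =
     Determinant.det (Matrix.mat N N
       (\<lambda>(i, j). if j = 0 then of_real (u i) powr (- z) else of_real (u i) ^ j))"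

definition selberg_const :: "nat \<Rightarrow> real \<Rightarrow> real \<Rightarrow> real" where
  "selberg_const N a b =
     (\<Prod>n<N. Gamma (a + real n) * Gamma (b + real n) * Gamma (2 + real n)
            / Gamma (a + b - 1 + real N + real n))"

(* trunc_Gamma M z is Gamma_M(z), Euler's product for the Gamma function cut off at M *)
definition trunc_Gamma :: "nat \<Rightarrow> complex \<Rightarrow> complex" where
  "trunc_Gamma M z =
     1 / z * (\<Prod>n = 1..M. of_real (1 + 1 / real n) powr z / (1 + z / of_nat n))"

(* The entire function of s that extends 2 / (s * trunc_Gamma M (s / 2)) *)
definition inv_trunc_Gamma :: "nat \<Rightarrow> complex \<Rightarrow> complex" where
  "inv_trunc_Gamma M s =
     (\<Prod>n = 1..M. (1 + s / (2 * of_nat n)) * of_real (1 + 1 / real n) powr (- (s / 2)))"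

(* With x / 0 = 0 the identity also holds at the poles s = -2n of trunc_Gamma M (s / 2),
   where both sides are 0. *)
lemma inv_trunc_Gamma_eq:
  assumes "s \<noteq> 0"
  shows "inv_trunc_Gamma M s = 2 / (s * trunc_Gamma M (s / 2))"
proof -
  have "inv_trunc_Gamma M s =
    (\<Prod>n = 1..M. inverse (of_real (1 + 1 / real n) powr (s / 2) / (1 + s / 2 / of_nat n)))"
    unfolding inv_trunc_Gamma_def
    by (intro prod.cong refl) (simp add: powr_minus field_simps del: of_real_add)
  also have "\<dots> = inverse (\<Prod>n = 1..M. of_real (1 + 1 / real n) powr (s / 2) / (1 + s / 2 / of_nat n))"
    by (rule prod_inversef [unfolded o_def])
  finally show ?thesis
    using assms unfolding trunc_Gamma_def by (simp only: field_simps) simp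
qed

end

theory Submission
  imports Defs
begin

text \<open>
  Andreief's identity turns each integral into \<open>N!\<close> times the determinant of one-dimensional moments.
  Up to row and column factors, the moments are \<open>\<Gamma>(y\<^sub>j + k)\<close> or \<open>B(y\<^sub>j, b + N - 1 - k)\<close>, where
  \<open>y\<^sub>0 = a - s/2\<close> and \<open>y\<^sub>j = a + j\<close> for \<open>j \<ge> 1\<close>.  After splitting off \<open>\<Gamma>(y\<^sub>j)\<close>, or
  \<open>\<Gamma>(y\<^sub>j) / \<Gamma>(y\<^sub>j + b + N - 1)\<close>, the entries are monic polynomials of degree \<open>k\<close> in \<open>y\<^sub>j\<close>, so what
  remains is a Vandermonde determinant in the \<open>y\<^sub>j\<close>.  In the Beta case the columns get these degrees
  because \<open>V\<^sub>N\<close> is rewritten as \<open>det ((1 - u\<^sub>i) ^ (N - 1 - k))\<close>.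
\<close>

section \<open>Vandermonde determinants\<close>

text \<open>The evaluation matrix factors as the Vandermonde matrix times the coefficient matrix
  \<open>?C\<close>. The latter is upper triangular with ones on the diagonal, so its determinant is
  1.\<close>

lemma det_poly_vandermonde:
  fixes p :: "nat \<Rightarrow> 'a :: comm_ring_1 poly"
  assumes deg: "\<And>k. k < n \<Longrightarrow> degree (p k) \<le> k"
    and lead: "\<And>k. k < n \<Longrightarrow> coeff (p k) k = 1"
  shows "Determinant.det (Matrix.mat n n (\<lambda>(i, k). poly (p k) (x i))) =
    Determinant.det (Matrix.mat n n (\<lambda>(i, k). x i ^ k))"
proof -
  let ?V = "Matrix.mat n n (\<lambda>(i, k). x i ^ k)"
  let ?C = "Matrix.mat n n (\<lambda>(l, k). coeff (p k) l)"
  have "poly (p k) y = (\<Sum>l<n. y ^ l * coeff (p k) l)" if "k < n" for k y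
  proof -
    have "poly (p k) y = (\<Sum>l\<le>degree (p k). coeff (p k) l * y ^ l)"
      by (simp add: poly_altdef)
    also have "\<dots> = (\<Sum>l<n. coeff (p k) l * y ^ l)"
      using deg[OF that] that
      by (intro sum.mono_neutral_left) (auto simp: coeff_eq_0 not_le)
    finally show ?thesis by (simp add: mult.commute)
  qed
  then have "Matrix.mat n n (\<lambda>(i, k). poly (p k) (x i)) = ?V * ?C"
    by (intro eq_matI) (auto simp: scalar_prod_def atLeast0LessThan)
  moreover have "Determinant.det ?C = prod_list (diag_mat ?C)"
  proof -
    have zero: "coeff (p k) l = 0" if "k < l" "l < n" for k l
      using deg[of k] that by (simp add: coeff_eq_0)
    show ?thesis
      by (intro det_upper_triangular[of _ n] upper_triangularI) (auto simp: zero)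
  qed
  moreover have "prod_list (diag_mat ?C) = (\<Prod>k<n. coeff (p k) k)"
    by (simp add: prod_list_diag_prod atLeast0LessThan)
  ultimately show ?thesis
    using lead by (simp add: det_mult[of _ n])
qed

text \<open>Provides the two premises of \<open>det_poly_vandermonde\<close> for the Newton basis
  and for rising factorials. They are proved together: the leading coefficient step needs the degree
  bound to kill the coefficient just above degree \<open>k\<close>.\<close>

lemma monic_prod_linear:
  fixes d :: "nat \<Rightarrow> 'a :: comm_ring_1"
  shows "degree (\<Prod>m<k. [:d m, 1:]) \<le> k" and "coeff (\<Prod>m<k. [:d m, 1:]) k = 1"
proof (induction k)
  case (Suc k)
  let ?p = "\<Prod>m<k. [:d m, 1:]"
  { case 1
    show ?case
      using degree_mult_le[of ?p "[:d k, 1:]"] degree_pCons_le[of "d k" "[:1:]"] Suc by simp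
  next
    case 2
    show ?case
      using Suc by (simp add: mult.commute[of ?p] coeff_eq_0) }
qed simp_all

lemma det_vandermonde:
  fixes x :: "nat \<Rightarrow> 'a :: comm_ring_1"
  shows "Determinant.det (Matrix.mat n n (\<lambda>(i, k). x i ^ k)) = (\<Prod>i<n. \<Prod>m<i. x i - x m)"
proof -
  \<comment> \<open>In the Newton basis with nodes \<open>x 0, x 1, \<dots>\<close> the evaluation matrix is triangular.\<close>
  define p where "p k = (\<Prod>m<k. [:- x m, 1:])" for k
  let ?L = "Matrix.mat n n (\<lambda>(i, k). poly (p k) (x i))"
  have eval: "poly (p k) y = (\<Prod>m<k. y - x m)" for k y
    by (simp add: p_def poly_prod)
  have "Determinant.det ?L = prod_list (diag_mat ?L)"
    by (rule det_lower_triangular[of n]) (auto simp: eval intro!: prod_zero)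
  also have "\<dots> = (\<Prod>i<n. \<Prod>m<i. x i - x m)"
    by (simp add: prod_list_diag_prod eval atLeast0LessThan)
  finally show ?thesis
    using det_poly_vandermonde[of n p x] monic_prod_linear[of "\<lambda>m. - x m"] by (simp add: p_def)
qed

text \<open>A rising factorial is monic of degree \<open>k\<close> in its node whatever the shift
  \<open>d k\<close> is, so a shift that varies from column to column does no harm. The Beta moments
  need such a shift.\<close>

lemma det_pochhammer:
  fixes x d :: "nat \<Rightarrow> 'a :: comm_ring_1"
  shows "Determinant.det (Matrix.mat n n (\<lambda>(i, k). pochhammer (x i + d k) k)) =
    (\<Prod>i<n. \<Prod>m<i. x i - x m)"
proof -
  define p where "p k = (\<Prod>m<k. [:d k + of_nat m, 1:])" for k
  have "pochhammer (y + d k) k = poly (p k) y" for y k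
    by (simp add: p_def poly_prod pochhammer_prod atLeast0LessThan add_ac)
  then show ?thesis
    using det_poly_vandermonde[of n p x] monic_prod_linear[of "\<lambda>m. d _ + of_nat m"]
    by (simp add: p_def det_vandermonde)
qed

text \<open>Reversing the rows and reversing the columns each cost the same sign, and the two signs
  cancel. The columns are reduced to rows by transposition.\<close>

lemma det_reverse:
  fixes f :: "nat \<Rightarrow> nat \<Rightarrow> 'a :: comm_ring_1"
  shows "Determinant.det (Matrix.mat n n (\<lambda>(i, j). f (n - 1 - i) (n - 1 - j))) =
    Determinant.det (Matrix.mat n n (\<lambda>(i, j). f i j))"
proof -
  \<comment> \<open>Being the identity beyond \<open>n\<close>, \<open>r\<close> is an involution,
    hence its own inverse witness, and a permutation of the index set.\<close>
  define r where "r i = (if i < n then n - 1 - i else i)" for i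
  have r: "r permutes {0..<n}"
    by (rule bij_imp_permutes) (auto simp: r_def intro!: bij_betw_byWitness[where f' = r])
  have rows: "Determinant.det (Matrix.mat n n (\<lambda>(i, j). g (n - 1 - i) j)) =
      signof r * Determinant.det (Matrix.mat n n (\<lambda>(i, j). g i j))" for g :: "nat \<Rightarrow> nat \<Rightarrow> 'a"
    unfolding det_permute_rows[OF mat_carrier r, symmetric]
    by (intro arg_cong[where f = Determinant.det] eq_matI) (auto simp: r_def)
  have tr: "Determinant.det (Matrix.mat n n (\<lambda>(i, j). g j i)) =
      Determinant.det (Matrix.mat n n (\<lambda>(i, j). g i j))" for g :: "nat \<Rightarrow> nat \<Rightarrow> 'a"
    unfolding det_transpose[OF mat_carrier, symmetric, of n "\<lambda>(i, j). g i j"]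
    by (intro arg_cong[where f = Determinant.det] eq_matI) auto
  have "Determinant.det (Matrix.mat n n (\<lambda>(i, j). f (n - 1 - i) (n - 1 - j))) =
      signof r * Determinant.det (Matrix.mat n n (\<lambda>(i, j). f j (n - 1 - i)))"
    using rows[of "\<lambda>i j. f i (n - 1 - j)"] tr[of "\<lambda>i j. f i (n - 1 - j)"] by simp
  also have "\<dots> = signof r * (signof r * Determinant.det (Matrix.mat n n (\<lambda>(i, j). f i j)))"
    using rows[of "\<lambda>i j. f j i"] tr[of f] by simp
  finally show ?thesis by (simp add: sign_def)
qed

text \<open>The map \<open>x\<close> to \<open>1 - x\<close> negates every difference, and reversing
  the order of the nodes negates it again.\<close>

lemma det_vandermonde_one_minus:
  fixes x :: "nat \<Rightarrow> 'a :: comm_ring_1"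
  shows "Determinant.det (Matrix.mat n n (\<lambda>(i, k). (1 - x i) ^ (n - 1 - k))) =
    Determinant.det (Matrix.mat n n (\<lambda>(i, k). x i ^ k))"
proof -
  have rev_prod: "(\<Prod>i<n. \<Prod>m<i. g (n - 1 - i) (n - 1 - m)) = (\<Prod>i<n. \<Prod>m<i. g m i)"
    for g :: "nat \<Rightarrow> nat \<Rightarrow> 'a"
    unfolding prod.Sigma[OF finite_lessThan ballI[OF finite_lessThan]]
    by (rule prod.reindex_bij_witness[where i = "\<lambda>(i, m). (n - 1 - m, n - 1 - i)"
          and j = "\<lambda>(i, m). (n - 1 - m, n - 1 - i)"]) auto
  have "Determinant.det (Matrix.mat n n (\<lambda>(i, k). (1 - x i) ^ (n - 1 - k))) =
      Determinant.det (Matrix.mat n n (\<lambda>(i, k). (1 - x (n - 1 - i)) ^ k))"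
    by (subst det_reverse[of n "\<lambda>i k. (1 - x (n - 1 - i)) ^ k", symmetric])
      (auto intro!: arg_cong[where f = Determinant.det])
  also have "\<dots> = (\<Prod>i<n. \<Prod>m<i. x i - x m)"
    unfolding det_vandermonde using rev_prod[of "\<lambda>i m. x m - x i"] by simp
  finally show ?thesis by (simp add: det_vandermonde)
qed

text \<open>Every Leibniz term meets each row and each column exactly once, so it carries all the
  factors.\<close>

lemma det_scale_rows_cols:
  fixes c :: "nat \<Rightarrow> nat \<Rightarrow> 'a :: comm_ring_1"
  shows "Determinant.det (Matrix.mat n n (\<lambda>(i, j). f i * g j * c i j)) =
    (\<Prod>i<n. f i) * (\<Prod>j<n. g j) * Determinant.det (Matrix.mat n n (\<lambda>(i, j). c i j))"
  unfolding det_def'[OF mat_carrier] sum_distrib_left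
proof (rule sum.cong)
  fix p assume "p \<in> {p. p permutes {0..<n}}"
  then have p: "p permutes {0..<n}" by simp
  have lt: "p i < n" if "i < n" for i using permutes_in_image[OF p, of i] that by simp
  have "(\<Prod>i = 0..<n. g (p i)) = (\<Prod>i = 0..<n. g i)"
    using prod.permute[OF p, of g] by (simp add: o_def)
  then show "signof p * (\<Prod>i = 0..<n. Matrix.mat n n (\<lambda>(i, j). f i * g j * c i j) $$ (i, p i)) =
      prod f {..<n} * prod g {..<n} *
        (signof p * (\<Prod>i = 0..<n. Matrix.mat n n (\<lambda>(i, j). c i j) $$ (i, p i)))"
    by (simp add: lt prod.distrib atLeast0LessThan mult_ac)
qed simp

section \<open>Andreief's identity and moments\<close>

lemma has_bochner_integral_PiM_prod:
  fixes f :: "'i \<Rightarrow> 'a \<Rightarrow> 'b :: {real_normed_field, banach, second_countable_topology}"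
  assumes "sigma_finite_measure M" "finite I" "\<And>i. i \<in> I \<Longrightarrow> has_bochner_integral M (f i) (c i)"
  shows "has_bochner_integral (Pi\<^sub>M I (\<lambda>_. M)) (\<lambda>u. \<Prod>i\<in>I. f i (u i)) (\<Prod>i\<in>I. c i)"
proof -
  interpret product_sigma_finite "\<lambda>_. M"
    using assms(1) by (simp add: product_sigma_finite_def)
  show ?thesis
    using assms(2,3) product_integrable_prod[of I f] product_integral_prod[of I f]
    by (simp add: has_bochner_integral_iff)
qed

text \<open>Both determinants are expanded over permutations \<open>p\<close> and \<open>q\<close>,
  and the product measure integrates each term factor by factor. For fixed \<open>p\<close>,
  replacing \<open>q\<close> by \<open>q \<circ> p\<close> turns the sum over \<open>q\<close> into
  the determinant of \<open>c\<close>; the choices of \<open>p\<close> then give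
  \<open>fact n\<close> equal copies.\<close>

lemma andreief:
  fixes \<phi> \<psi> :: "nat \<Rightarrow> 'a \<Rightarrow> 'b :: {real_normed_field, banach, second_countable_topology}"
  assumes M: "sigma_finite_measure M"
    and c: "\<And>j k. j < n \<Longrightarrow> k < n \<Longrightarrow> has_bochner_integral M (\<lambda>x. \<phi> j x * \<psi> k x * w x) (c j k)"
  shows "has_bochner_integral (Pi\<^sub>M {..<n} (\<lambda>_. M))
    (\<lambda>u. Determinant.det (Matrix.mat n n (\<lambda>(i, j). \<phi> j (u i))) *
         Determinant.det (Matrix.mat n n (\<lambda>(i, k). \<psi> k (u i))) * (\<Prod>i<n. w (u i)))
    (fact n * Determinant.det (Matrix.mat n n (\<lambda>(j, k). c j k)))"
proof -
  let ?P = "{p. p permutes {..<n}}"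
  have lt: "p i < n" if "p \<in> ?P" "i < n" for p i
    using permutes_in_image[of p "{..<n}" i] that by simp
  have det: "Determinant.det (Matrix.mat n n (\<lambda>(i, j). f i j)) =
      (\<Sum>p\<in>?P. signof p * (\<Prod>i<n. f i (p i)))" for f :: "nat \<Rightarrow> nat \<Rightarrow> 'b"
    unfolding det_def'[OF mat_carrier] atLeast0LessThan
    by (intro sum.cong refl arg_cong2[where f = "(*)"] prod.cong) (auto simp: lt)
  have inner: "(\<Sum>q\<in>?P. signof p * signof q * (\<Prod>i<n. c (p i) (q i))) =
      Determinant.det (Matrix.mat n n (\<lambda>(j, k). c j k))" if p: "p \<in> ?P" for p
  proof -
    have "(\<Sum>q\<in>?P. signof p * signof q * (\<Prod>i<n. c (p i) (q i))) =
        (\<Sum>q\<in>?P. signof p * signof (q \<circ> p) * (\<Prod>i<n. c (p i) ((q \<circ> p) i)))"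
      using p by (intro sum_permutations_compose_right) auto
    also have "\<dots> = (\<Sum>q\<in>?P. signof q * (\<Prod>i<n. c i (q i)))"
    proof (intro sum.cong refl)
      fix q assume q: "q \<in> ?P"
      have "permutation p" "permutation q"
        using p q by (auto simp: permutation_permutes)
      then have "signof p * signof (q \<circ> p) = (signof q :: 'b)"
        by (simp add: sign_def evenperm_comp)
      moreover have "(\<Prod>i<n. c (p i) (q (p i))) = (\<Prod>i<n. c i (q i))"
        using prod.permute[of p "{..<n}" "\<lambda>i. c i (q i)"] p by (simp add: o_def)
      ultimately show "signof p * signof (q \<circ> p) * (\<Prod>i<n. c (p i) ((q \<circ> p) i)) =
          signof q * (\<Prod>i<n. c i (q i))" by simp
    qed
    finally show ?thesis by (simp add: det)
  qed
  have "has_bochner_integral (Pi\<^sub>M {..<n} (\<lambda>_. M))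
      (\<lambda>u. \<Sum>p\<in>?P. \<Sum>q\<in>?P. signof p * signof q * (\<Prod>i<n. \<phi> (p i) (u i) * \<psi> (q i) (u i) * w (u i)))
      (\<Sum>p\<in>?P. \<Sum>q\<in>?P. signof p * signof q * (\<Prod>i<n. c (p i) (q i)))"
    by (intro has_bochner_integral_sum has_bochner_integral_mult_right
        has_bochner_integral_PiM_prod M c) (auto simp: lt)
  also have "(\<Sum>p\<in>?P. \<Sum>q\<in>?P. signof p * signof q * (\<Prod>i<n. c (p i) (q i))) =
      fact n * Determinant.det (Matrix.mat n n (\<lambda>(j, k). c j k))"
    by (simp add: inner card_permutations[of "{..<n}" n])
  also have "(\<lambda>u. \<Sum>p\<in>?P. \<Sum>q\<in>?P. signof p * signof q *
        (\<Prod>i<n. \<phi> (p i) (u i) * \<psi> (q i) (u i) * w (u i))) =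
      (\<lambda>u. Determinant.det (Matrix.mat n n (\<lambda>(i, j). \<phi> j (u i))) *
         Determinant.det (Matrix.mat n n (\<lambda>(i, k). \<psi> k (u i))) * (\<Prod>i<n. w (u i)))"
    unfolding det sum_product
    unfolding sum_distrib_right
    by (simp add: prod.distrib mult_ac)
  finally show ?thesis .
qed

section \<open>One-dimensional Gamma and Beta integrals with complex exponents\<close>

lemma borel_measurable_of_real_powr [measurable]:
  "(\<lambda>x. complex_of_real x powr c) \<in> borel_measurable borel"
proof -
  \<comment> \<open>\<open>Ln\<close> jumps across the negative axis, but along the real line it is
    explicit: its imaginary part is \<open>pi\<close> on the negative side, and
    \<open>0 powr c = 0\<close> by convention.\<close>
  have "complex_of_real x powr c = (if x = 0 then 0
      else exp (c * (of_real (ln \<bar>x\<bar>) + (if x < 0 then of_real pi else 0) * \<i>)))" for x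
    using Ln_of_real'[of x] by (auto simp: powr_def)
  then show ?thesis by simp
qed

lemma not_nonpos_Ints_Re_pos: "Re y > 0 \<Longrightarrow> y \<notin> \<int>\<^sub>\<le>\<^sub>0"
  by (auto simp: nonpos_Ints_def)

lemma Gamma_nonzero_Re_pos: "Re y > 0 \<Longrightarrow> Gamma y \<noteq> 0"
  using not_nonpos_Ints_Re_pos by (simp add: Gamma_eq_zero_iff)

text \<open>Transfers the Henstock-Kurzweil form of Euler's integral to the Bochner integral over
  \<open>lborel\<close>, as product measures and Fubini require.\<close>

lemma has_bochner_integral_Gamma:
  assumes "Re z > 0"
  shows "has_bochner_integral lborel
    (\<lambda>x. indicator {0<..} x *\<^sub>R (of_real x powr (z - 1) * of_real (exp (- x)))) (Gamma z)"
proof -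
  let ?f = "\<lambda>t. complex_of_real t powr (z - 1) / of_real (exp t)"
  have "set_integrable lborel {0<..} ?f"
    using absolutely_integrable_Gamma_integral'[OF assms]
    unfolding set_integrable_def by (subst (asm) integrable_completion) auto
  moreover from set_borel_integral_eq_integral[OF this] Gamma_integral_complex'[OF assms]
  have "(LINT x : {0<..} | lborel. ?f x) = Gamma z" by (simp add: integral_unique)
  ultimately show ?thesis
    unfolding has_bochner_integral_iff set_integrable_def set_lebesgue_integral_def
    by (simp add: exp_minus divide_inverse)
qed

lemma has_bochner_integral_Gamma_scaled:
  assumes "Re z > 0" and "\<theta> > 0"
  shows "has_bochner_integral lborel
    (\<lambda>x. indicator {0<..} x *\<^sub>R (of_real x powr (z - 1) * of_real (exp (- x / \<theta>))))
    (Gamma z * of_real \<theta> powr z)"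
proof -
  let ?f = "\<lambda>x. indicator {0<..} x *\<^sub>R (of_real x powr (z - 1) * complex_of_real (exp (- x / \<theta>)))"
  \<comment> \<open>The argument has the shape of an affine substitution with translation 0. The
    Jacobian \<open>\<theta>\<close> later raises the exponent \<open>z - 1\<close> to
    \<open>z\<close>.\<close>
  have eq: "?f (0 + \<theta> * x) = of_real \<theta> powr (z - 1) *
      (indicator {0<..} x *\<^sub>R (of_real x powr (z - 1) * of_real (exp (- x))))" for x
    using assms(2) by (auto simp: indicator_def powr_times_real zero_less_mult_iff)
  have "has_bochner_integral lborel (\<lambda>x. ?f (0 + \<theta> * x)) (of_real \<theta> powr (z - 1) * Gamma z)"
    unfolding eq by (intro has_bochner_integral_mult_right has_bochner_integral_Gamma assms)
  also have "of_real \<theta> powr (z - 1) * Gamma z = (Gamma z * of_real \<theta> powr z) /\<^sub>R \<bar>\<theta>\<bar>"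
    using assms(2) by (simp add: powr_diff scaleR_conv_of_real field_simps)
  finally show ?thesis
    using assms(2) by (subst lborel_has_bochner_integral_real_affine_iff[of \<theta> _ _ 0]) auto
qed

text \<open>Fubini for \<open>x powr (z - 1) * (r - x) powr (b - 1) * exp (- r)\<close> on
  \<open>0 < x < r\<close>. Integrating first over \<open>r = x + y\<close> gives the product of
  \<open>Gamma b\<close> and \<open>Gamma z\<close>; integrating first over \<open>x = r * t\<close>
  gives the Beta integral times \<open>Gamma (z + b)\<close>.\<close>

lemma has_bochner_integral_Beta:
  assumes z: "Re z > 0" and b: "b > 0"
  shows "has_bochner_integral lborel
    (\<lambda>x. indicator {0<..<1} x *\<^sub>R (of_real x powr (z - 1) * of_real ((1 - x) powr (b - 1))))
    (Beta z (of_real b))"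
proof -
  let ?beta = "\<lambda>z x. indicator {0<..<1::real} x
                *\<^sub>R (of_real x powr (z - 1) * complex_of_real ((1 - x) powr (b - 1)))"
  have int: "integrable lborel (?beta z)"
  proof (rule Bochner_Integration.integrable_bound)
    show "integrable lborel (\<lambda>x. indicator {0..1} x *\<^sub>R (x powr (Re z - 1) * (1 - x) powr (b - 1)))"
      using integrable_Beta[OF z b] by (simp add: set_integrable_def)
    show "AE x in lborel. norm (?beta z x) \<le>
        norm (indicat_real {0..1} x *\<^sub>R (x powr (Re z - 1) * (1 - x) powr (b - 1)))"
      by (intro AE_I2) (auto simp: indicator_def norm_mult norm_powr_real_powr)
  qed measurable
  let ?g = "\<lambda>z x r. indicator {0<..<r} x *\<^sub>R (of_real x powr (z - 1) *
              complex_of_real ((r - x) powr (b - 1) * exp (- r)))"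
  \<comment> \<open>Kept general in \<open>z\<close>, because the absolute integrability below uses
    it at the real exponent \<open>Re z\<close> as well.\<close>
  have slice: "has_bochner_integral lborel (?g z x)
      (Gamma (of_real b) * (indicator {0<..} x *\<^sub>R (of_real x powr (z - 1) * of_real (exp (- x)))))"
    for x z
  proof (cases "x > 0")
    case True
    have "?g z x (x + 1 * y) = (of_real x powr (z - 1) * of_real (exp (- x))) *
        (indicator {0<..} y *\<^sub>R (of_real y powr (of_real b - 1) * of_real (exp (- y))))" for y
    proof (cases "y > 0")
      case y: True
      have "exp (- (x + 1 * y)) = exp (- x) * exp (- y)"
        using exp_add[of "- x" "- y"] by simp
      moreover have "of_real y powr (of_real b - 1) = complex_of_real (y powr (b - 1))"
        using y powr_of_real[of y "b - 1"] by simp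
      ultimately show ?thesis using True y by simp
    qed (use True in simp)
    then have "has_bochner_integral lborel (\<lambda>y. ?g z x (x + 1 * y))
        ((of_real x powr (z - 1) * of_real (exp (- x))) * Gamma (of_real b))"
      using b by (simp only:) (intro has_bochner_integral_mult_right has_bochner_integral_Gamma, simp)
    then show ?thesis
      using True by (subst lborel_has_bochner_integral_real_affine_iff[of 1 _ _ x])
        (auto simp: mult_ac)
  qed (auto simp: indicator_def cong: if_cong)
  have norm_g: "norm (?g z x r) = Re (?g (of_real (Re z)) x r)" for x r
    using powr_of_real[of x "Re z - 1"] by (simp add: indicator_def norm_mult norm_powr_real_powr)
  \<comment> \<open>By \<open>norm_g\<close> the absolute value is the same integrand at
    \<open>Re z\<close>, so its inner integrals are a constant times a Gamma integrand.\<close>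
  have prod: "integrable (lborel \<Otimes>\<^sub>M lborel) (\<lambda>(x, r). ?g z x r)"
  proof (rule lborel_pair.Fubini_integrable)
    show "(\<lambda>(x, r). ?g z x r) \<in> borel_measurable (lborel \<Otimes>\<^sub>M lborel)"
      unfolding case_prod_beta indicator_def greaterThanLessThan_iff by measurable
    have "(\<integral>r. norm (?g z x r) \<partial>lborel) = Re (Gamma (of_real b) *
       (indicator {0<..} x *\<^sub>R (of_real x powr (of_real (Re z) - 1) * of_real (exp (- x)))))" for x
      unfolding norm_g
      by (intro has_bochner_integral_integral_eq
          has_bochner_integral_bounded_linear[OF bounded_linear_Re slice])
    moreover have "integrable lborel (\<lambda>x. Re (Gamma (of_real b) *
       (indicator {0<..} x *\<^sub>R (of_real x powr (of_real (Re z) - 1) * of_real (exp (- x))))))"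
      using has_bochner_integral_Gamma[of "of_real (Re z)"] z
      by (intro integrable_Re integrable_mult_right) (simp add: has_bochner_integral_iff)
    ultimately show "integrable lborel (\<lambda>x. \<integral>r. norm (case (x, r) of (x, r) \<Rightarrow> ?g z x r) \<partial>lborel)"
      by simp
    show "AE x in lborel. integrable lborel (\<lambda>r. case (x, r) of (x, r) \<Rightarrow> ?g z x r)"
      using slice[where z = z] by (auto simp: has_bochner_integral_iff)
  qed
  have other: "(\<integral>x. ?g z x r \<partial>lborel) = integral\<^sup>L lborel (?beta z) *
      (indicator {0<..} r *\<^sub>R (of_real r powr (z + of_real b - 1) * of_real (exp (- r))))" for r
  proof (cases "r > 0")
    case True
    \<comment> \<open>The powers of \<open>r\<close> combine to \<open>z + b - 2\<close>, and the
      Jacobian \<open>r\<close> supplies the missing one.\<close>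
    have eq: "?g z (0 + r * t) r = of_real r powr (z + of_real b - 2) * of_real (exp (- r)) * ?beta z t" for t
    proof (cases "0 < t \<and> t < 1")
      case t: True
      have "(r - r * t) powr (b - 1) = r powr (b - 1) * (1 - t) powr (b - 1)"
        using True t powr_mult[of r "1 - t" "b - 1"] by (simp add: algebra_simps)
      moreover have "of_real r powr (of_real b - 1) = complex_of_real (r powr (b - 1))"
        using True powr_of_real[of r "b - 1"] by simp
      moreover have "complex_of_real r powr (z + of_real b - 2) =
          of_real r powr (z - 1) * of_real r powr (of_real b - 1)"
        by (simp add: powr_add[symmetric] algebra_simps)
      ultimately show ?thesis
        using True t by (auto simp: indicator_def powr_times_real)
    qed (use True in \<open>auto simp: indicator_def zero_less_mult_iff\<close>)
    have "(\<integral>x. ?g z x r \<partial>lborel) = r *\<^sub>R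
        (of_real r powr (z + of_real b - 2) * of_real (exp (- r)) * integral\<^sup>L lborel (?beta z))"
      using True by (subst lborel_integral_real_affine[of r _ 0])
        (simp, unfold eq integral_mult_right_zero, simp)
    moreover have "of_real r powr (z + of_real b - 1) = of_real r * complex_of_real r powr (z + of_real b - 2)"
    proof -
      have "z + of_real b - 1 = 1 + (z + of_real b - 2)" by simp
      then show ?thesis using True by (simp only: powr_add) simp
    qed
    ultimately show ?thesis
      using True by (simp add: scaleR_conv_of_real mult_ac)
  qed (auto simp: indicator_def cong: if_cong)
  have "(\<integral>x. \<integral>r. ?g z x r \<partial>lborel \<partial>lborel) = Gamma (of_real b) * Gamma z"
    unfolding has_bochner_integral_integral_eq[OF slice]
    by (intro has_bochner_integral_integral_eq has_bochner_integral_mult_right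
        has_bochner_integral_Gamma z)
  moreover have "(\<integral>r. \<integral>x. ?g z x r \<partial>lborel \<partial>lborel) =
      integral\<^sup>L lborel (?beta z) * Gamma (z + of_real b)"
    unfolding other using z b
    by (intro has_bochner_integral_integral_eq has_bochner_integral_mult_right
        has_bochner_integral_Gamma) simp
  moreover note lborel_pair.Fubini_integral[OF prod]
  ultimately have "integral\<^sup>L lborel (?beta z) * Gamma (z + of_real b) = Gamma (of_real b) * Gamma z"
    by (simp only:)
  then have "integral\<^sup>L lborel (?beta z) = Beta z (of_real b)"
    using Gamma_nonzero_Re_pos[of "z + of_real b"] z b
    by (simp only: Beta_def eq_divide_eq) (simp add: mult.commute)
  with int show ?thesis by (simp add: has_bochner_integral_iff)
qed

section \<open>Generalized Vandermonde integrals\<close>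

text \<open>Treats the exceptional first column as one more complex power. Adding \<open>a\<close>
  gives the nodes \<open>y\<^sub>j\<close> of the overview.\<close>

definition gen_vandermonde_exponent :: "complex \<Rightarrow> nat \<Rightarrow> complex" where
  "gen_vandermonde_exponent z j = (if j = 0 then - z else of_nat j)"

text \<open>Only the factor at \<open>j = 0\<close> leaves the progression \<open>a + j\<close>.
  Applied to \<open>Gamma\<close>, to \<open>rGamma\<close> and to powers of \<theta>, this produces
  all the quotients in the results.\<close>

lemma prod_gen_vandermonde_exponent:
  assumes "0 < n" and "h a \<noteq> 0"
  shows "(\<Prod>j<n. h (a + gen_vandermonde_exponent z j)) =
    h (a - z) / h a * (\<Prod>j<n. h (a + of_nat j) :: complex)"
proof -
  obtain m where "n = Suc m" using assms(1) gr0_implies_Suc by blast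
  then show ?thesis
    using assms(2)
    by (simp add: prod.lessThan_Suc_shift gen_vandermonde_exponent_def del: prod.lessThan_Suc)
qed

text \<open>Row \<open>i > 0\<close> contributes
  \<open>(i + s/2) * fact (i - 1) = (1 + s/(2*i)) * fact i\<close>. These factorials and
  \<open>fact n\<close> make up the product of the \<open>Gamma (2 + k)\<close>. The powers of
  \<open>1 + 1/i\<close> in \<open>inv_trunc_Gamma\<close> telescope against
  \<open>n powr (s/2)\<close>.\<close>

lemma vandermonde_gen_vandermonde_exponent:
  fixes s :: complex
  defines "\<alpha> \<equiv> gen_vandermonde_exponent (s / 2)"
  assumes "0 < n"
  shows "fact n * (\<Prod>i<n. \<Prod>m<i. \<alpha> i - \<alpha> m) =
    of_real (\<Prod>k<n. Gamma (2 + real k)) * of_nat n powr (s / 2) * inv_trunc_Gamma (n - 1) s"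
  using assms(2)
proof (induction n rule: nat_induct_non_zero)
  case 1
  show ?case by (simp add: inv_trunc_Gamma_def Gamma_numeral)
next
  case (Suc n)
  then obtain k where k: "n = Suc k" using gr0_implies_Suc by blast
  \<comment> \<open>In the new row, node 0 gives \<open>n + s/2\<close>, while the nodes
    \<open>1, ..., n - 1\<close> give \<open>fact (n - 1)\<close>.\<close>
  have "(\<Prod>m<k. of_nat n - of_nat (Suc m)) = (\<Prod>m<k. of_nat (k - m) :: complex)"
    by (intro prod.cong) (auto simp: k of_nat_diff)
  then have last: "(\<Prod>m<n. \<alpha> n - \<alpha> m) = (of_nat n + s / 2) * fact k"
    using k fact_prod_rev[where 'a = complex, of k]
    by (simp add: \<alpha>_def gen_vandermonde_exponent_def prod.lessThan_Suc_shift atLeast0LessThan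
        del: prod.lessThan_Suc)
  have "complex_of_real (1 + 1 / real n) = of_real (real (Suc n) / real n)"
    using k by (simp add: field_simps)
  then have "complex_of_real (1 + 1 / real n) powr (- (s / 2)) =
      of_nat n powr (s / 2) / of_nat (Suc n) powr (s / 2)"
    using powr_times_real[of "of_real (1 + 1 / real n)" "of_nat n" "s / 2"] k
    by (simp add: powr_minus field_simps del: of_nat_Suc of_real_add)
  then have inv: "of_nat (Suc n) powr (s / 2) * inv_trunc_Gamma n s =
      of_nat n powr (s / 2) * inv_trunc_Gamma (n - 1) s * (1 + s / (2 * of_nat n))"
    using k by (simp add: inv_trunc_Gamma_def del: of_nat_Suc of_real_add)
  have G: "Gamma (2 + real n) = fact (Suc n)"
    using Gamma_fact[where 'a = real, of "Suc n"] by (simp add: add_ac)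
  have "fact (Suc n) * (\<Prod>i<Suc n. \<Prod>m<i. \<alpha> i - \<alpha> m) =
      (fact n * (\<Prod>i<n. \<Prod>m<i. \<alpha> i - \<alpha> m)) * (of_nat (Suc n) * (\<Prod>m<n. \<alpha> n - \<alpha> m))"
    by (simp add: mult_ac)
  also have "of_nat (Suc n) * (\<Prod>m<n. \<alpha> n - \<alpha> m) =
      of_real (Gamma (2 + real n)) * (1 + s / (2 * of_nat n))"
  proof -
    have "of_nat n + s / 2 = of_nat n * (1 + s / (2 * of_nat n))"
      using k by (simp add: field_simps del: of_nat_Suc)
    moreover have "complex_of_real (fact (Suc n)) = of_nat (Suc n) * (of_nat n * fact k)"
      by (simp add: k)
    ultimately show ?thesis unfolding last G by (simp only: mult_ac)
  qed
  finally show ?case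
    unfolding Suc.IH using inv by (simp add: mult_ac del: of_nat_Suc)
qed

text \<open>Positivity matters in the first column, since \<open>0 powr 0 = 0\<close>.\<close>

lemma gen_vandermonde_0:
  assumes "\<And>i. i < N \<Longrightarrow> u i > 0"
  shows "gen_vandermonde N 0 u = Determinant.det (Matrix.mat N N (\<lambda>(i, k). of_real (u i) ^ k))"
  unfolding gen_vandermonde_def
  using assms by (intro arg_cong[where f = Determinant.det] eq_matI) (auto, force)

lemma gen_vandermonde_pos:
  assumes "\<And>i. i < N \<Longrightarrow> u i > 0"
  shows "gen_vandermonde N z u = Determinant.det (Matrix.mat N N
    (\<lambda>(i, j). of_real (u i) powr gen_vandermonde_exponent z j))"
  unfolding gen_vandermonde_def gen_vandermonde_exponent_def
  using assms by (intro arg_cong[where f = Determinant.det] eq_matI) (auto simp: powr_nat')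

text \<open>Andreief's identity with the indicator of \<open>S\<close> absorbed into the weight. The
  family \<open>\<psi>\<close> is left free so that \<open>V\<^sub>N\<close> can be expanded in
  powers of \<open>u\<close> or of \<open>1 - u\<close>, whichever suits the weight.\<close>

lemma has_bochner_integral_gen_vandermonde:
  assumes S: "S \<subseteq> {0<..}"
    and moments: "\<And>j k. j < N \<Longrightarrow> k < N \<Longrightarrow> has_bochner_integral lborel
      (\<lambda>x. indicator S x *\<^sub>R (of_real x powr gen_vandermonde_exponent z j * \<psi> k x * of_real (w x))) (c j k)"
    and \<psi>: "\<And>u. Determinant.det (Matrix.mat N N (\<lambda>(i, k). \<psi> k (u i))) =
      Determinant.det (Matrix.mat N N (\<lambda>(i, k). complex_of_real (u i) ^ k))"
  shows "has_bochner_integral (Pi\<^sub>M {..<N} (\<lambda>_. lborel))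
    (\<lambda>u. indicator (Pi\<^sub>E {..<N} (\<lambda>_. S)) u *\<^sub>R
      (gen_vandermonde N z u * gen_vandermonde N 0 u * (\<Prod>n<N. of_real (w (u n)))))
    (fact N * Determinant.det (Matrix.mat N N (\<lambda>(j, k). c j k)))"
proof -
  have "has_bochner_integral (Pi\<^sub>M {..<N} (\<lambda>_. lborel))
    (\<lambda>u. Determinant.det (Matrix.mat N N (\<lambda>(i, j). of_real (u i) powr gen_vandermonde_exponent z j)) *
         Determinant.det (Matrix.mat N N (\<lambda>(i, k). \<psi> k (u i))) *
         (\<Prod>i<N. indicator S (u i) *\<^sub>R of_real (w (u i))))
    (fact N * Determinant.det (Matrix.mat N N (\<lambda>(j, k). c j k)))"
    using moments by (intro andreief lborel.sigma_finite_measure_axioms) simp_all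
  moreover have "Determinant.det (Matrix.mat N N (\<lambda>(i, j). of_real (u i) powr gen_vandermonde_exponent z j)) *
         Determinant.det (Matrix.mat N N (\<lambda>(i, k). \<psi> k (u i))) *
         (\<Prod>i<N. indicator S (u i) *\<^sub>R of_real (w (u i))) =
      indicator (Pi\<^sub>E {..<N} (\<lambda>_. S)) u *\<^sub>R
      (gen_vandermonde N z u * gen_vandermonde N 0 u * (\<Prod>n<N. of_real (w (u n))))"
    \<comment> \<open>Points of the product space are extensional, so membership in the cube is a
      coordinatewise condition.\<close>
    if u: "u \<in> space (Pi\<^sub>M {..<N} (\<lambda>_. lborel))" for u
  proof (cases "\<forall>i<N. u i \<in> S")
    case True
    with S have "u i > 0" if "i < N" for i using that by auto
    with True u show ?thesis
      by (simp add: gen_vandermonde_0 gen_vandermonde_pos[of _ _ z] \<psi> space_PiM PiE_iff)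
  next
    case False
    then obtain i where "i < N" "u i \<notin> S" by blast
    then have "(\<Prod>i<N. indicator S (u i) *\<^sub>R complex_of_real (w (u i))) = 0"
      by (intro prod_zero) (auto intro!: bexI[of _ i])
    with False show ?thesis by (auto simp: indicator_def PiE_iff)
  qed
  ultimately show ?thesis
    by (simp cong: has_bochner_integral_cong)
qed

section \<open>Evaluation for the Laguerre weight\<close>

lemma Re_exponent_pos:
  assumes "a > 0" "Re (of_real a - z) > 0"
  shows "Re (of_real a + gen_vandermonde_exponent z j) > 0"
  using assms by (simp add: gen_vandermonde_exponent_def)

lemma Gamma_add_of_nat:
  fixes y :: complex
  assumes "Re y > 0"
  shows "Gamma (y + of_nat k) = Gamma y * pochhammer y k"
  using pochhammer_Gamma[OF not_nonpos_Ints_Re_pos[OF assms], of k] Gamma_nonzero_Re_pos[OF assms]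
  by simp

lemma prod_Gamma_exponent:
  assumes "0 < N" and "a > 0"
  shows "(\<Prod>j<N. Gamma (of_real a + gen_vandermonde_exponent z j)) =
    Gamma (of_real a - z) / Gamma (of_real a) * of_real (\<Prod>n<N. Gamma (a + real n))"
proof -
  have "Gamma (complex_of_real a) \<noteq> 0" using assms(2) by (simp add: Gamma_nonzero_Re_pos)
  then have "(\<Prod>j<N. Gamma (of_real a + gen_vandermonde_exponent z j)) =
      Gamma (of_real a - z) / Gamma (of_real a) * (\<Prod>n<N. Gamma (of_real a + of_nat n))"
    by (rule prod_gen_vandermonde_exponent[OF assms(1)])
  also have "(\<Prod>n<N. Gamma (of_real a + of_nat n)) = complex_of_real (\<Prod>n<N. Gamma (a + real n))"
    by (simp flip: Gamma_complex_of_real)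
  finally show ?thesis .
qed

lemma prod_powr_exponent:
  assumes "0 < N" and "\<theta> > 0"
  shows "(\<Prod>j<N. of_real \<theta> powr (of_real a + gen_vandermonde_exponent z j)) =
    of_real \<theta> powr (- z) * complex_of_real (\<Prod>n<N. \<theta> powr (a + real n))"
proof -
  have "(\<Prod>j<N. of_real \<theta> powr (of_real a + gen_vandermonde_exponent z j)) =
      of_real \<theta> powr (of_real a - z) / of_real \<theta> powr of_real a *
      (\<Prod>n<N. complex_of_real \<theta> powr (of_real a + of_nat n))"
    using assms(2)
    by (intro prod_gen_vandermonde_exponent[OF assms(1), where h = "\<lambda>x. of_real \<theta> powr x"]) simp
  moreover have "of_real \<theta> powr (of_real a - z) / complex_of_real \<theta> powr of_real a = of_real \<theta> powr (- z)"
    using assms(2) by (simp add: powr_diff powr_minus field_simps)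
  moreover have "of_real \<theta> powr (of_real a + of_nat n) = complex_of_real (\<theta> powr (a + real n))" for n
    using powr_of_real[of \<theta> "a + real n"] assms(2) by simp
  ultimately show ?thesis by (simp only: of_real_prod)
qed

text \<open>Collects the row and column powers of \<theta>: the sum of \<open>(a + n) + n\<close>
  over \<open>n < N\<close> is \<open>(a + N - 1) * N\<close>.\<close>

lemma prod_powr_mult_prod_power:
  fixes a \<theta> :: real
  assumes "\<theta> > 0"
  shows "(\<Prod>n<N. \<theta> powr (a + real n)) * (\<Prod>n<N. \<theta> ^ n) = \<theta> powr ((a + real N - 1) * real N)"
proof (induction N)
  case (Suc N)
  have "\<theta> powr ((a + real (Suc N) - 1) * real (Suc N)) =
      \<theta> powr ((a + real N - 1) * real N) * (\<theta> powr (a + real N) * \<theta> powr real N)"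
    unfolding powr_add[symmetric] by (simp add: algebra_simps)
  with Suc assms show ?case by (simp add: powr_realpow mult_ac)
qed (use assms in simp)

text \<open>With \<open>y\<close> the node of row \<open>j\<close>, the moment
  \<open>Gamma (y + k) * \<theta> powr (y + k)\<close> splits into a row factor, the column factor
  \<open>\<theta> ^ k\<close> and \<open>pochhammer y k\<close>, so \<open>det_pochhammer\<close>
  applies with shift 0.\<close>

lemma laguerre_gen_vandermonde_integral:
  assumes N: "0 < N" and a: "a > 0" and \<theta>: "\<theta> > 0" and s: "Re (of_real a - s / 2) > 0"
  shows "has_bochner_integral (Pi\<^sub>M {..<N} (\<lambda>_. lborel))
       (\<lambda>u. indicator (Pi\<^sub>E {..<N} (\<lambda>_. {0<..})) u *\<^sub>R
          (gen_vandermonde N (s / 2) u * gen_vandermonde N 0 u *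
           (\<Prod>n<N. of_real (u n powr (a - 1) * exp (- u n / \<theta>)))))
       (of_real (\<Prod>n<N. Gamma (a + real n) * Gamma (2 + real n))
        * (of_real (\<theta> powr ((a + real N - 1) * real N)) * inv_trunc_Gamma (N - 1) s)
        * of_real (real N / \<theta>) powr (s / 2)
        * (Gamma (of_real a - s / 2) / Gamma (of_real a)))"
proof -
  let ?\<alpha> = "gen_vandermonde_exponent (s / 2)"
  let ?y = "\<lambda>j. of_real a + ?\<alpha> j"
  let ?c = "\<lambda>j k. (Gamma (?y j) * of_real \<theta> powr ?y j) * of_real (\<theta> ^ k) * pochhammer (?y j + 0) k"
  have y: "Re (?y j) > 0" for j by (rule Re_exponent_pos[OF a s])
  have moment: "has_bochner_integral lborel
      (\<lambda>x. indicator {0<..} x *\<^sub>R (of_real x powr ?\<alpha> j * of_real x ^ k *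
        of_real (x powr (a - 1) * exp (- x / \<theta>)))) (?c j k)" for j k
  proof -
    have "has_bochner_integral lborel
        (\<lambda>x. indicator {0<..} x *\<^sub>R (of_real x powr (?y j + of_nat k - 1) * of_real (exp (- x / \<theta>))))
        (Gamma (?y j + of_nat k) * of_real \<theta> powr (?y j + of_nat k))"
      using y[of j] by (intro has_bochner_integral_Gamma_scaled \<theta>) simp
    moreover have "indicator {0<..} x *\<^sub>R (of_real x powr (?y j + of_nat k - 1) * of_real (exp (- x / \<theta>))) =
        indicator {0<..} x *\<^sub>R (of_real x powr ?\<alpha> j * of_real x ^ k *
        complex_of_real (x powr (a - 1) * exp (- x / \<theta>)))" for x
    proof (cases "x > 0")
      case True
      have "of_real x powr (?y j + of_nat k - 1) =
          of_real x powr ?\<alpha> j * of_real x powr of_nat k * complex_of_real x powr (of_real (a - 1))"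
        unfolding powr_add[symmetric] by (simp add: algebra_simps)
      also have "\<dots> = of_real x powr ?\<alpha> j * of_real x ^ k * complex_of_real (x powr (a - 1))"
        using True powr_of_real[of x "a - 1"] by (simp add: powr_nat')
      finally show ?thesis by simp
    qed simp
    moreover have "Gamma (?y j + of_nat k) * of_real \<theta> powr (?y j + of_nat k) = ?c j k"
      using \<theta> unfolding Gamma_add_of_nat[OF y] powr_add[of _ _ "of_nat k"]
      by (simp add: powr_nat' mult_ac)
    ultimately show ?thesis by (simp only:)
  qed
  \<comment> \<open>Isolates \<open>\<theta> powr (- (s / 2))\<close>, the contribution of the
    exceptional first exponent.\<close>
  have powN: "of_real (real N / \<theta>) powr (s / 2) = of_nat N powr (s / 2) * of_real \<theta> powr (- (s / 2))"
    using \<theta> N powr_times_real[of "of_real (real N / \<theta>)" "of_real \<theta>" "s / 2"]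
    by (simp add: powr_minus field_simps)
  have "fact N * Determinant.det (Matrix.mat N N (\<lambda>(j, k). ?c j k)) =
      (\<Prod>j<N. Gamma (?y j)) * ((\<Prod>j<N. of_real \<theta> powr ?y j) * of_real (\<Prod>k<N. \<theta> ^ k)) *
      (fact N * (\<Prod>i<N. \<Prod>m<i. ?\<alpha> i - ?\<alpha> m))"
    unfolding det_scale_rows_cols det_pochhammer
    by (simp only: prod.distrib of_real_prod mult_ac add_diff_cancel_left)
  also have "\<dots> = of_real (\<Prod>n<N. Gamma (a + real n) * Gamma (2 + real n))
        * (of_real (\<theta> powr ((a + real N - 1) * real N)) * inv_trunc_Gamma (N - 1) s)
        * of_real (real N / \<theta>) powr (s / 2)
        * (Gamma (of_real a - s / 2) / Gamma (of_real a))"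
    unfolding prod_Gamma_exponent[OF N a] prod_powr_exponent[OF N \<theta>] powN
      vandermonde_gen_vandermonde_exponent[OF N] prod_powr_mult_prod_power[OF \<theta>, symmetric]
    by (simp only: prod.distrib of_real_mult mult_ac)
  finally have det: "fact N * Determinant.det (Matrix.mat N N (\<lambda>(j, k). ?c j k)) = \<dots>" .
  show ?thesis
    unfolding det[symmetric]
    by (rule has_bochner_integral_gen_vandermonde[where \<psi> = "\<lambda>k x. of_real x ^ k", OF order.refl moment refl])
qed

section \<open>Evaluation for the Jacobi weight\<close>

lemma selberg_const_altdef:
  "selberg_const N a b = (\<Prod>n<N. Gamma (a + real n)) * (\<Prod>n<N. Gamma (b + real n)) *
    (\<Prod>n<N. Gamma (2 + real n)) * (\<Prod>n<N. rGamma (a + b - 1 + real N + real n))"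
  by (simp add: selberg_const_def rGamma_inverse_Gamma divide_inverse prod.distrib)

lemma prod_rGamma_exponent:
  assumes "0 < N" and "a > 0" and "B > 0"
  shows "(\<Prod>j<N. rGamma (of_real a + gen_vandermonde_exponent z j + of_real B)) =
    Gamma (of_real (a + B)) / Gamma (of_real a - z + of_real B) *
    complex_of_real (\<Prod>n<N. rGamma (a + B + real n))"
proof -
  have "Gamma (of_real a + complex_of_real B) \<noteq> 0"
    using assms(2,3) by (simp add: Gamma_nonzero_Re_pos)
  then have "(\<Prod>j<N. rGamma (of_real a + gen_vandermonde_exponent z j + of_real B)) =
      rGamma (of_real a - z + of_real B) / rGamma (of_real a + of_real B) *
      (\<Prod>n<N. rGamma (of_real a + of_nat n + complex_of_real B))"
    by (intro prod_gen_vandermonde_exponent[OF assms(1), where h = "\<lambda>x. rGamma (x + of_real B)"])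
      (simp add: rGamma_inverse_Gamma)
  moreover have "rGamma (of_real a + of_nat n + of_real B) = complex_of_real (rGamma (a + B + real n))" for n
    by (simp add: add_ac flip: rGamma_complex_of_real)
  ultimately show ?thesis
    by (simp add: rGamma_inverse_Gamma field_simps)
qed

text \<open>Since \<open>b' k + k = B\<close> for every column, \<open>Gamma (y + b' k)\<close>
  equals \<open>Gamma (y + B) / pochhammer (y + b' k) k\<close>. Hence \<open>Beta y (b' k)\<close>
  splits into a row factor, a column factor and a rising factorial of degree
  \<open>k\<close>.\<close>

lemma jacobi_gen_vandermonde_integral:
  assumes N: "0 < N" and a: "a > 0" and b: "b > 0" and s: "Re (of_real a - s / 2) > 0"
  shows "has_bochner_integral (Pi\<^sub>M {..<N} (\<lambda>_. lborel))
       (\<lambda>u. indicator (Pi\<^sub>E {..<N} (\<lambda>_. {0<..<1})) u *\<^sub>R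
          (gen_vandermonde N (s / 2) u * gen_vandermonde N 0 u *
           (\<Prod>n<N. of_real (u n powr (a - 1) * (1 - u n) powr (b - 1)))))
       (of_nat N powr (s / 2) * of_real (selberg_const N a b) * inv_trunc_Gamma (N - 1) s
        * (Gamma (of_real (a + b - 1 + real N)) / Gamma (of_real a - s / 2 + of_real (b - 1 + real N)))
        * (Gamma (of_real a - s / 2) / Gamma (of_real a)))"
proof -
  let ?\<alpha> = "gen_vandermonde_exponent (s / 2)"
  let ?y = "\<lambda>j. of_real a + ?\<alpha> j"
  define B where "B = b - 1 + real N"
  define b' where "b' k = b + real (N - 1 - k)" for k
  let ?c = "\<lambda>j k. (Gamma (?y j) * rGamma (?y j + of_real B)) * of_real (Gamma (b' k)) *
        pochhammer (?y j + of_real (b' k)) k"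
  have B: "B > 0" using b N by (simp add: B_def)
  have y: "Re (?y j) > 0" for j by (rule Re_exponent_pos[OF a s])
  have moment: "has_bochner_integral lborel
      (\<lambda>x. indicator {0<..<1} x *\<^sub>R (of_real x powr ?\<alpha> j * of_real (1 - x) ^ (N - 1 - k) *
        of_real (x powr (a - 1) * (1 - x) powr (b - 1)))) (?c j k)" if k: "k < N" for j k
  proof -
    \<comment> \<open>The bound \<open>k < N\<close> makes the natural subtraction
      \<open>N - 1 - k\<close> exact.\<close>
    have b': "b' k > 0" "b' k + real k = B"
      using b k by (simp_all add: b'_def B_def of_nat_diff)
    have "has_bochner_integral lborel
        (\<lambda>x. indicator {0<..<1} x *\<^sub>R (of_real x powr (?y j - 1) * of_real ((1 - x) powr (b' k - 1))))
        (Beta (?y j) (of_real (b' k)))"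
      by (intro has_bochner_integral_Beta y b')
    moreover have "indicator {0<..<1} x *\<^sub>R (of_real x powr (?y j - 1) * of_real ((1 - x) powr (b' k - 1))) =
        indicator {0<..<1} x *\<^sub>R (of_real x powr ?\<alpha> j * of_real (1 - x) ^ (N - 1 - k) *
        complex_of_real (x powr (a - 1) * (1 - x) powr (b - 1)))" for x
    proof (cases "0 < x \<and> x < 1")
      case True
      have "of_real x powr (?y j - 1) = of_real x powr ?\<alpha> j * complex_of_real x powr (of_real (a - 1))"
        unfolding powr_add[symmetric] by (simp add: algebra_simps)
      also have "complex_of_real x powr (of_real (a - 1)) = of_real (x powr (a - 1))"
        using True by (intro powr_of_real) simp
      finally have "of_real x powr (?y j - 1) = of_real x powr ?\<alpha> j * complex_of_real (x powr (a - 1))" .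
      moreover have "(1 - x) powr (b' k - 1) = (1 - x) ^ (N - 1 - k) * (1 - x) powr (b - 1)"
        using True unfolding b'_def
        by (subst powr_realpow[symmetric]) (auto simp: powr_add[symmetric] algebra_simps)
      ultimately show ?thesis by simp
    qed auto
    moreover have "Beta (?y j) (of_real (b' k)) = ?c j k"
    proof -
      have pos: "Re (?y j + of_real (b' k)) > 0" using y[of j] b' by simp
      have "?y j + of_real B = (?y j + of_real (b' k)) + of_nat k"
        unfolding b'(2)[symmetric] by simp
      then have "Gamma (?y j + of_real B) =
          Gamma (?y j + of_real (b' k)) * pochhammer (?y j + of_real (b' k)) k"
        by (simp only: Gamma_add_of_nat[OF pos])
      moreover have "Gamma (?y j + of_real B) \<noteq> 0"
        using y[of j] B by (intro Gamma_nonzero_Re_pos) simp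
      ultimately show ?thesis
        by (simp add: Beta_def rGamma_inverse_Gamma Gamma_complex_of_real field_simps)
    qed
    ultimately show ?thesis by (simp only:)
  qed
  have aB: "a + B = a + b - 1 + real N" by (simp add: B_def)
  have "(\<Prod>k<N. Gamma (b' k)) = (\<Prod>k<N. Gamma (b + real k))"
    using prod.nat_diff_reindex[of "\<lambda>k. Gamma (b + real k)" N] by (simp add: b'_def)
  then have g: "(\<Prod>k<N. complex_of_real (Gamma (b' k))) = of_real (\<Prod>k<N. Gamma (b + real k))"
    by (simp only: flip: of_real_prod)
  have "fact N * Determinant.det (Matrix.mat N N (\<lambda>(j, k). ?c j k)) =
      (\<Prod>j<N. Gamma (?y j)) * (\<Prod>j<N. rGamma (?y j + of_real B)) *
      (\<Prod>k<N. of_real (Gamma (b' k))) * (fact N * (\<Prod>i<N. \<Prod>m<i. ?\<alpha> i - ?\<alpha> m))"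
    unfolding det_scale_rows_cols det_pochhammer
    by (simp only: prod.distrib mult_ac add_diff_cancel_left)
  also have "\<dots> = of_nat N powr (s / 2) * of_real (selberg_const N a b) * inv_trunc_Gamma (N - 1) s
        * (Gamma (of_real (a + b - 1 + real N)) / Gamma (of_real a - s / 2 + of_real (b - 1 + real N)))
        * (Gamma (of_real a - s / 2) / Gamma (of_real a))"
    unfolding prod_Gamma_exponent[OF N a] prod_rGamma_exponent[OF N a B] g
      vandermonde_gen_vandermonde_exponent[OF N] selberg_const_altdef aB
    by (simp only: B_def of_real_mult mult_ac)
  finally have det: "fact N * Determinant.det (Matrix.mat N N (\<lambda>(j, k). ?c j k)) = \<dots>" .
  have \<psi>: "Determinant.det (Matrix.mat N N (\<lambda>(i, k). complex_of_real (1 - u i) ^ (N - 1 - k))) =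
      Determinant.det (Matrix.mat N N (\<lambda>(i, k). of_real (u i) ^ k))" for u
    using det_vandermonde_one_minus[of N "\<lambda>i. complex_of_real (u i)"] by simp
  show ?thesis
    unfolding det[symmetric]
    by (rule has_bochner_integral_gen_vandermonde
        [where \<psi> = "\<lambda>k x. of_real (1 - x) ^ (N - 1 - k)", OF _ moment \<psi>]) auto
qed

text \<open>Substituting \<open>u = \<theta> v\<close> in the second integral fixes its power of
  \<theta>: \<open>N\<close> from the differentials, \<open>N (a - 1)\<close> from the weight and
  \<open>N (N - 1) - s/2\<close> from the two determinants, in total
  \<open>(a + N - 1) N - s/2\<close>. The exponent \<open>(a + N) N\<close> in the prose formula is
  thus too large by \<open>N\<close>; the version proved has \<open>(a + N - 1) N\<close>.\<close>

theorem corollary7: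
  fixes N :: nat and a b \<theta> :: real and s :: complex
  assumes "N \<ge> 2" and "a > 0" and "b > 0" and "\<theta> > 0"
    and "Re (of_real a - s / 2) > 0"
  shows
    "has_bochner_integral (Pi\<^sub>M {..<N} (\<lambda>_. lborel))
       (\<lambda>u. indicator (Pi\<^sub>E {..<N} (\<lambda>_. {0<..<1})) u *\<^sub>R
          (gen_vandermonde N (s / 2) u * gen_vandermonde N 0 u *
           (\<Prod>n<N. of_real (u n powr (a - 1) * (1 - u n) powr (b - 1)))))
       (of_nat N powr (s / 2) * of_real (selberg_const N a b) * inv_trunc_Gamma (N - 1) s
        * (Gamma (of_real (a + b - 1 + real N)) / Gamma (of_real a - s / 2 + of_real (b - 1 + real N)))
        * (Gamma (of_real a - s / 2) / Gamma (of_real a)))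
     \<and>
     has_bochner_integral (Pi\<^sub>M {..<N} (\<lambda>_. lborel))
       (\<lambda>u. indicator (Pi\<^sub>E {..<N} (\<lambda>_. {0<..})) u *\<^sub>R
          (gen_vandermonde N (s / 2) u * gen_vandermonde N 0 u *
           (\<Prod>n<N. of_real (u n powr (a - 1) * exp (- u n / \<theta>)))))
       (of_real (\<Prod>n<N. Gamma (a + real n) * Gamma (2 + real n))
        * (of_real (\<theta> powr ((a + real N - 1) * real N)) * inv_trunc_Gamma (N - 1) s)
        * of_real (real N / \<theta>) powr (s / 2)
        * (Gamma (of_real a - s / 2) / Gamma (of_real a)))"
  using assms jacobi_gen_vandermonde_integral[of N a b s] laguerre_gen_vandermonde_integral[of N a \<theta> s]
  by simp

end
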